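(* Let $m\ge 4$ and let $n\ge \frac{m(m-1)}{2}$ be integers. Then \[RS_m(n)\ge \left\lceil \frac{(m-3)n+\frac{m(m-1)}{2}}{m-2}\right\rceil.\]
   Context: For $m\ge 3$, $E_m$ denotes the equation $x_1+x_2+\cdots+x_{m-1}=x_m$. For a positive integer $n$, $[1,n]=\{1,2,\ldots,n\}$. An $r$-coloring of a set $S$ is a map $S\to\{1,\ldots,r\}$; it is exact if it is surjective. A solution to $E_m$ in $[1,n]$ is a tuple $(x_1,\ldots,x_m)$ of elements of $[1,n]$ satisfying $E_m$; under a coloring it is rainbow if the $m$ elements $x_1,\ldots,x_m$ receive pairwise distinct colors. For $m\ge 3$ and $n\ge \frac{m(m-1)}{2}$, the rainbow Schur number $RS_m(n)$ is the minimum positive integer $r$ such that every exact $r$-coloring of $[1,n]$ admits a rainbow solution to $E_m$ in $[1,n]$. *)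

theory Defs
  imports Complex_Main "HOL-Library.FuncSet"
begin

definition coloring :: "nat \<Rightarrow> 'a set \<Rightarrow> ('a \<Rightarrow> nat) \<Rightarrow> bool" where
  "coloring r S c \<longleftrightarrow> c \<in> S \<rightarrow> {1..r}"

definition exact_coloring :: "nat \<Rightarrow> 'a set \<Rightarrow> ('a \<Rightarrow> nat) \<Rightarrow> bool" where
  "exact_coloring r S c \<longleftrightarrow> coloring r S c \<and> c ` S = {1..r}"

text \<open>A tuple \<open>(x\<^sub>1, \<dots>, x\<^sub>m)\<close> is a function on indices, of which only the values at
  \<open>1, \<dots>, m\<close> matter.\<close>

definition solution :: "nat \<Rightarrow> nat \<Rightarrow> (nat \<Rightarrow> nat) \<Rightarrow> bool" where
  "solution m n x \<longleftrightarrow> (\<forall>i\<in>{1..m}. x i \<in> {1..n}) \<and> (\<Sum>i = 1..m - 1. x i) = x m"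

definition rainbow :: "nat \<Rightarrow> (nat \<Rightarrow> nat) \<Rightarrow> (nat \<Rightarrow> nat) \<Rightarrow> bool" where
  "rainbow m c x \<longleftrightarrow> (\<forall>i\<in>{1..m}. \<forall>j\<in>{1..m}. i \<noteq> j \<longrightarrow> c (x i) \<noteq> c (x j))"

text \<open>The minimum is over a nonempty set, since \<open>{1..n}\<close> has no exact \<open>r\<close>-coloring for \<open>r > n\<close>.
  It is the rainbow Schur number only for \<open>m \<ge> 3\<close> and \<open>n \<ge> m (m - 1) / 2\<close>; then it is at most
  \<open>n\<close>, because an exact \<open>n\<close>-coloring is injective and \<open>1 + 2 + \<dots> + (m - 1) \<le> n\<close>.\<close>

definition rainbow_schur :: "nat \<Rightarrow> nat \<Rightarrow> nat" where
  "rainbow_schur m n =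
     (LEAST r. r > 0 \<and>
        (\<forall>c. exact_coloring r {1..n} c \<longrightarrow> (\<exists>x. solution m n x \<and> rainbow m c x)))"

end

(* Give the numbers 1, ..., a one common color, with a = n - r + 1, and all larger numbers
   distinct further colors.  This uses r colors.  The summands of a rainbow solution are distinct
   and at most one of them is \<le> a, so their sum is at least
   1 + (a + 1) + \<dots> + (a + m - 2), which exceeds n when r is below the bound. *)

theory Submission
  imports Defs
begin

text \<open>The extreme case is \<open>A\<close> consisting of a+1, ..., a+k with k =
  \<open>card A\<close>; both sides are doubled to avoid a division.\<close>

lemma sum_greaterThan_ge:
  fixes A :: "nat set"
  assumes "finite A" and "A \<subseteq> {a<..}"
  shows "card A * (2 * a + card A + 1) \<le> 2 * \<Sum>A"
  using assms
proof (induction A rule: finite_linorder_max_induct)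
  case empty
  then show ?case by simp
next
  case (insert b A)
  \<comment> \<open>The new maximum \<open>b\<close> leaves room for only b-a-1 elements between
    \<open>a\<close> and \<open>b\<close>, which forces \<open>b\<close> to be large.\<close>
  have "A \<subseteq> {a<..<b}"
    using insert by auto
  then have "card A \<le> card {a<..<b}"
    by (rule card_mono[rotated]) simp
  then have "a + card A + 1 \<le> b"
    using insert.prems by auto
  moreover have "b \<notin> A"
    using insert by auto
  moreover have "card A * (2 * a + card A + 1) \<le> 2 * \<Sum>A"
    using insert by auto
  ultimately show ?case
    using insert.hyps by (simp add: algebra_simps)
qed

text \<open>Subtraction truncates at 0, so exactly the numbers up to d+1 get color 1; beyond that
  the map is injective.\<close>

definition initial_merge :: "nat \<Rightarrow> nat \<Rightarrow> nat" where
  "initial_merge d x = max 1 (x - d)"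

lemma exact_coloring_initial_merge:
  assumes "0 < r" and "r \<le> n"
  shows "exact_coloring r {1..n} (initial_merge (n - r))"
proof -
  have "initial_merge (n - r) ` {1..n} = {1..r}"
  proof (intro equalityI subsetI)
    fix y assume "y \<in> {1..r}"
    then have "y = initial_merge (n - r) (y + (n - r))" and "y + (n - r) \<in> {1..n}"
      using assms by (auto simp: initial_merge_def)
    then show "y \<in> initial_merge (n - r) ` {1..n}"
      by blast
  qed (use assms in \<open>auto simp: initial_merge_def\<close>)
  then show ?thesis
    by (auto simp: exact_coloring_def coloring_def)
qed

text \<open>The left side is twice 1 + (d+2) + ... + (d+m-1), the least sum of m-1 positive numbers
  with pairwise distinct colors.\<close>

lemma rainbow_solution_initial_merge_ge:
  assumes "2 \<le> m" and sol: "solution m n x" and rb: "rainbow m (initial_merge d) x"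
  shows "2 + (m - 2) * (2 * d + m + 1) \<le> 2 * n"
proof -
  let ?I = "{1..m - 1}"
  define X where "X = x ` ?I"
  have ne: "initial_merge d (x i) \<noteq> initial_merge d (x j)"
    if "i \<in> ?I" "j \<in> ?I" "i \<noteq> j" for i j
    using rb that unfolding rainbow_def by auto
  then have inj: "inj_on x ?I"
    by (metis inj_onI)
  have X: "finite X" "card X = m - 1" "X \<subseteq> {1..n}"
    using card_image[OF inj] sol by (auto simp: X_def solution_def)
  have neX: "initial_merge d u \<noteq> initial_merge d v" if uv: "u \<in> X" "v \<in> X" "u \<noteq> v" for u v
  proof -
    obtain i j where ij: "i \<in> ?I" "j \<in> ?I" "u = x i" "v = x j"
      using uv unfolding X_def by blast
    with \<open>u \<noteq> v\<close> show ?thesis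
      using ne[of i j] by auto
  qed
  \<comment> \<open>Take for \<open>y\<close> the summand of color 1 if there is one, and any
    summand otherwise.\<close>
  have "\<exists>y\<in>X. X - {y} \<subseteq> {d + 1<..}"
  proof (cases "\<exists>y\<in>X. y \<le> d + 1")
    case True
    then obtain y where y: "y \<in> X" "y \<le> d + 1"
      by blast
    \<comment> \<open>Otherwise \<open>y\<close> and \<open>z\<close> would both have color
      1.\<close>
    have "z > d + 1" if "z \<in> X - {y}" for z
      using neX[of y z] y that by (auto simp: initial_merge_def)
    with y show ?thesis
      by auto
  next
    case False
    moreover have "X \<noteq> {}"
      using X \<open>2 \<le> m\<close> by auto
    ultimately show ?thesis
      by (metis DiffD1 ex_in_conv greaterThan_iff not_le subsetI)
  qed
  then obtain y where y: "y \<in> X" "X - {y} \<subseteq> {d + 1<..}"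
    by blast
  have "card (X - {y}) = m - 2"
    using X y by simp
  moreover have "2 * (d + 1) + (m - 2) + 1 = 2 * d + m + 1"
    using \<open>2 \<le> m\<close> by simp
  ultimately have "(m - 2) * (2 * d + m + 1) \<le> 2 * \<Sum>(X - {y})"
    using sum_greaterThan_ge[OF finite_Diff[OF X(1)] y(2)] by (simp only:)
  moreover have "\<Sum>X = y + \<Sum>(X - {y})"
    using X y by (simp add: sum.remove)
  moreover have "y \<ge> 1"
    using X y by auto
  moreover have "\<Sum>X = x m"
    unfolding X_def using sol sum.reindex[OF inj, of id] by (simp add: solution_def)
  moreover have "x m \<le> n"
    using sol \<open>2 \<le> m\<close> by (auto simp: solution_def)
  ultimately show ?thesis
    by linarith
qed

text \<open>The minimum is attained because n+1 qualifies vacuously: n elements cannot take n+1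
  colors.\<close>

lemma rainbow_schur_spec:
  "rainbow_schur m n > 0 \<and>
    (\<forall>c. exact_coloring (rainbow_schur m n) {1..n} c \<longrightarrow> (\<exists>x. solution m n x \<and> rainbow m c x))"
  unfolding rainbow_schur_def
proof (rule LeastI)
  have "\<not> exact_coloring (Suc n) {1..n} c" for c
    using card_image_le[of "{1..n}" c] by (auto simp: exact_coloring_def)
  then show "Suc n > 0 \<and>
    (\<forall>c. exact_coloring (Suc n) {1..n} c \<longrightarrow> (\<exists>x. solution m n x \<and> rainbow m c x))"
    by simp
qed

theorem theorem1:
  fixes m n :: nat
  assumes "m \<ge> 4" and "n \<ge> m * (m - 1) div 2"
  shows "int (rainbow_schur m n) \<ge>
    \<lceil>((real m - 3) * real n + real m * (real m - 1) / 2) / (real m - 2)\<rceil>"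
proof (rule ccontr)
  define r where "r = rainbow_schur m n"
  assume "\<not> ?thesis"
  then have "real r < ((real m - 3) * real n + real m * (real m - 1) / 2) / (real m - 2)"
    by (simp add: r_def not_le less_ceiling_iff)
  then have r_less: "real r * (real m - 2) < (real m - 3) * real n + real m * (real m - 1) / 2"
    using assms(1) by (simp add: pos_less_divide_eq)
  \<comment> \<open>Evenness makes the \<open>div 2\<close> in the hypothesis on \<open>n\<close> an
    exact halving.\<close>
  have "even (m * (m - 1))"
    by auto
  then have "m * (m - 1) \<le> 2 * n"
    using assms(2) by (metis dvd_mult_div_cancel mult_le_mono2)
  then have "real (m * (m - 1)) \<le> real (2 * n)"
    by (rule of_nat_mono)
  \<comment> \<open>This brings the claimed bound down to at most \<open>n\<close>, hence
    \<open>r \<le> n\<close>, so that \<open>n - r\<close> is a true difference.\<close>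
  then have "real m * (real m - 1) / 2 \<le> real n"
    using assms(1) by (simp add: of_nat_diff)
  with r_less have "real r * (real m - 2) < (real m - 3) * real n + real n"
    by linarith
  also have "\<dots> = real n * (real m - 2)"
    by (simp add: algebra_simps)
  finally have "real r * (real m - 2) < real n * (real m - 2)" .
  then have "r \<le> n"
    using assms(1) by (simp add: mult_less_cancel_right)
  moreover have "r > 0"
    using rainbow_schur_spec by (simp add: r_def)
  ultimately have "exact_coloring r {1..n} (initial_merge (n - r))"
    by (intro exact_coloring_initial_merge)
  then obtain x where "solution m n x" "rainbow m (initial_merge (n - r)) x"
    using rainbow_schur_spec unfolding r_def by blast
  then have "2 + (m - 2) * (2 * (n - r) + m + 1) \<le> 2 * n"
    using assms(1) by (intro rainbow_solution_initial_merge_ge) auto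
  then have "real (2 + (m - 2) * (2 * (n - r) + m + 1)) \<le> real (2 * n)"
    by (rule of_nat_mono)
  moreover have "real (m - 2) = real m - 2" and "real (n - r) = real n - real r"
    using assms(1) \<open>r \<le> n\<close> by (simp_all add: of_nat_diff)
  ultimately have "2 + (real m - 2) * (2 * (real n - real r) + real m + 1) \<le> 2 * real n"
    by (simp only: of_nat_add of_nat_mult of_nat_numeral of_nat_1)
  \<comment> \<open>In this form the previous inequality reads 2(m-3)n + m(m-1) \<le> 2r(m-2), the
    negation of \<open>r_less\<close> doubled.\<close>
  moreover have "(real m - 2) * (2 * (real n - real r) + real m + 1) =
      2 * (real m - 3) * real n + 2 * real n + real m * (real m - 1) - 2 - 2 * (real r * (real m - 2))"
    by (simp add: algebra_simps)
  ultimately show False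
    using r_less by linarith
qed

end
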